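(* For every integer $g\ge1$ and every scheduling algorithm (deterministic or randomized) for single-machine non-clairvoyant scheduling with Poisson stochastic progress bars of granularity $g$, the expected competitive ratio is at least $1+\frac{1}{36}g^{-1/3}$; that is, there is an instance on which $\mathbb{E}[\mathrm{ALG}]\ge (1+\frac1{36}g^{-1/3})\,\mathrm{OPT}$.
   Context: Single-machine preemptive scheduling of $n$ jobs available at time $0$ with unknown processing times $p_j>0$, minimizing total completion time $\sum_jC_j$; capacity may be shared arbitrarily among unfinished jobs; $\mathrm{OPT}$ is the optimal value. Stochastic progress bar of granularity $g$: for each job $j$ independently, let $\tilde\beta_j^{(1)}\le\dots\le\tilde\beta_j^{(g)}$ be the first $g$ points of a Poisson point process of rate $g$ on $\mathbb{R}_+$, $\beta_j^{(h)}=\min(1,\tilde\beta_j^{(h)})$, $\beta_j^{(g+1)}=1$, and $\varphi_j(x)=\frac1{g+1}\sum_{h=1}^{g+1}\mathbb{1}(x\ge\beta_j^{(h)})$. The scheduler observes at each time the displayed progress $\varphi_j(e_j/p_j)$ of each job, where $e_j$ is its elapsed processing. Expectation is over the progress bars and the algorithm's randomness. *)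

theory Defs
  imports "HOL-Probability.Probability"
begin

text \<open>
  The jobs of an instance are \<open>0, \<dots>, n - 1\<close> and \<open>p j\<close> is the processing time of job \<open>j\<close>.
  A schedule is given by the rates \<open>r j t\<close>, the share of the machine that job \<open>j\<close> receives
  at time \<open>t\<close>; only \<open>j < n\<close> and \<open>t \<ge> 0\<close> matter.
\<close>

type_synonym rates = "nat \<Rightarrow> real \<Rightarrow> real"

definition elapsed :: "rates \<Rightarrow> nat \<Rightarrow> real \<Rightarrow> real" where
  "elapsed r j t = integral {0..t} (r j)"

definition schedule :: "nat \<Rightarrow> (nat \<Rightarrow> real) \<Rightarrow> rates \<Rightarrow> bool" where
  "schedule n p r \<longleftrightarrow>
     (\<forall>j<n. \<forall>t\<ge>0. r j integrable_on {0..t}) \<and>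
     (\<forall>t\<ge>0. (\<forall>j<n. 0 \<le> r j t \<and> (p j \<le> elapsed r j t \<longrightarrow> r j t = 0)) \<and>
             (\<Sum>j<n. r j t) \<le> 1)"

text \<open>The completion time is \<open>\<infinity>\<close> for a job that is never completed.\<close>

definition completion_time :: "(nat \<Rightarrow> real) \<Rightarrow> rates \<Rightarrow> nat \<Rightarrow> ennreal" where
  "completion_time p r j = (INF t\<in>{t. 0 \<le> t \<and> p j \<le> elapsed r j t}. ennreal t)"

definition total_completion_time :: "nat \<Rightarrow> (nat \<Rightarrow> real) \<Rightarrow> rates \<Rightarrow> ennreal" where
  "total_completion_time n p r = (\<Sum>j<n. completion_time p r j)"

definition OPT :: "nat \<Rightarrow> (nat \<Rightarrow> real) \<Rightarrow> ennreal" where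
  "OPT n p = (INF r\<in>{r. schedule n p r}. total_completion_time n p r)"

text \<open>
  The points of a Poisson process of rate \<open>g\<close> on the half-line are the partial sums of
  independent exponential gaps of parameter \<open>g\<close>. For each job only the first \<open>g\<close> points are
  needed; \<open>w (j, i)\<close> is the \<open>i\<close>-th gap of job \<open>j\<close>. The gaps are almost surely
  positive, and the null set on which some gap is not positive is removed from the sample space.
\<close>

definition bar_space :: "nat \<Rightarrow> nat \<Rightarrow> (nat \<times> nat \<Rightarrow> real) measure" where
  "bar_space g n =
     restrict_space
       (\<Pi>\<^sub>M x\<in>{..<n} \<times> {1..g}. density lborel (exponential_density (real g)))
       {w. \<forall>x\<in>{..<n} \<times> {1..g}. 0 < w x}"

definition poisson_point :: "(nat \<times> nat \<Rightarrow> real) \<Rightarrow> nat \<Rightarrow> nat \<Rightarrow> real" where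
  "poisson_point w j h = (\<Sum>i=1..h. w (j, i))"

definition threshold :: "nat \<Rightarrow> (nat \<times> nat \<Rightarrow> real) \<Rightarrow> nat \<Rightarrow> nat \<Rightarrow> real" where
  "threshold g w j h = (if h \<le> g then min 1 (poisson_point w j h) else 1)"

definition progress :: "nat \<Rightarrow> (nat \<times> nat \<Rightarrow> real) \<Rightarrow> nat \<Rightarrow> real \<Rightarrow> real" where
  "progress g w j x = (\<Sum>h=1..g + 1. of_bool (threshold g w j h \<le> x)) / (real g + 1)"

text \<open>
  The history at time \<open>t\<close> is the displayed progress of all jobs at all times up to \<open>t\<close>.
  A policy chooses the current rates as a function of the current time and the history. The
  processing times and the progress bars enter the history through the display only.
  Completion is observable, since the display reaches \<open>1\<close> exactly when a job is completed.
\<close>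

type_synonym history = "real \<Rightarrow> nat \<Rightarrow> real"
type_synonym policy = "real \<Rightarrow> history \<Rightarrow> nat \<Rightarrow> real"

definition history ::
  "nat \<Rightarrow> nat \<Rightarrow> (nat \<Rightarrow> real) \<Rightarrow> (nat \<times> nat \<Rightarrow> real) \<Rightarrow> rates \<Rightarrow> real \<Rightarrow> history" where
  "history g n p w r t =
     (\<lambda>s\<in>{0..t}. \<lambda>j\<in>{..<n}. progress g w j (elapsed r j s / p j))"

definition execution ::
  "nat \<Rightarrow> nat \<Rightarrow> (nat \<Rightarrow> real) \<Rightarrow> (nat \<times> nat \<Rightarrow> real) \<Rightarrow> policy \<Rightarrow> rates \<Rightarrow> bool" where
  "execution g n p w \<pi> r \<longleftrightarrow>
     schedule n p r \<and> (\<forall>t\<ge>0. \<forall>j<n. r j t = \<pi> t (history g n p w r t) j)"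

text \<open>
  Executions are unique on \<open>j < n\<close>, \<open>t \<ge> 0\<close>: displays are right-continuous step functions
  of time, so two executions cannot start to differ. Hence the choice below is immaterial.
\<close>

definition run ::
  "nat \<Rightarrow> nat \<Rightarrow> (nat \<Rightarrow> real) \<Rightarrow> (nat \<times> nat \<Rightarrow> real) \<Rightarrow> policy \<Rightarrow> rates" where
  "run g n p w \<pi> = (SOME r. execution g n p w \<pi> r)"

text \<open>
  A randomized algorithm draws a seed \<open>\<omega>\<close> from \<open>S\<close>, independently of the progress bars, and
  follows the policy \<open>A \<omega> n\<close> on instances with \<open>n\<close> jobs; it is deterministic when \<open>S\<close> is
  a one-point space. Its policies must be executable on every instance and every realization of
  the bars, and the resulting state at any time must be a random variable.
\<close>

definition scheduling_algorithm :: "nat \<Rightarrow> 's measure \<Rightarrow> ('s \<Rightarrow> nat \<Rightarrow> policy) \<Rightarrow> bool" where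
  "scheduling_algorithm g S A \<longleftrightarrow>
     prob_space S \<and>
     (\<forall>n p. (\<forall>j<n. 0 < p j) \<longrightarrow>
        (\<forall>\<omega>\<in>space S. \<forall>w\<in>space (bar_space g n). \<exists>r. execution g n p w (A \<omega> n) r) \<and>
        (\<forall>j<n. \<forall>t\<ge>0. (\<lambda>(\<omega>, w). elapsed (run g n p w (A \<omega> n)) j t)
                        \<in> borel_measurable (S \<Otimes>\<^sub>M bar_space g n)))"

definition expected_cost ::
  "nat \<Rightarrow> 's measure \<Rightarrow> ('s \<Rightarrow> nat \<Rightarrow> policy) \<Rightarrow> nat \<Rightarrow> (nat \<Rightarrow> real) \<Rightarrow> ennreal" where
  "expected_cost g S A n p =
     (\<integral>\<^sup>+\<omega>. \<integral>\<^sup>+w. total_completion_time n p (run g n p w (A \<omega> n)) \<partial>bar_space g n \<partial>S)"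

end

theory Submission
  imports Defs
begin

text \<open>
  Take two jobs and \<open>x = g powr (- 1 / 3) / 2\<close>. When both have processing time 1, one of the jobs,
  say \<open>k\<close>, is with probability at least 1/2 not the second one to receive \<open>x\<close> units of processing.
  Now make job \<open>k\<close> longer by \<open>x\<close>. On that event the algorithm still pays at least \<open>x\<close> more than
  the optimum \<open>3 + x\<close>: it either finishes the long job first or has already spent \<open>x\<close> on it.
  The event depends only on the points of job \<open>k\<close> up to elapsed time \<open>x\<close>, where the rate of the
  Poisson process drops from \<open>g\<close> to \<open>g / (1 + x)\<close>; the second moment of the likelihood ratio is at
  most \<open>M = exp (g * x ^ 3)\<close>, so by Cauchy--Schwarz the probability of the event in the new instance
  is at least \<open>1 / (4 * M)\<close>.
\<close>

section \<open>Schedules and executions\<close>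

lemma elapsed_0 [simp]: "elapsed r j 0 = 0"
  by (simp add: elapsed_def)

lemma schedule_rate_le_1:
  assumes "schedule n p r" "j < n" "0 \<le> t"
  shows "r j t \<le> 1"
proof -
  have "r j t \<le> (\<Sum>j<n. r j t)"
    using assms by (intro member_le_sum) (auto simp: schedule_def)
  also have "\<dots> \<le> 1"
    using assms by (auto simp: schedule_def)
  finally show ?thesis .
qed

text \<open>Rates lie between 0 and 1. The two bounds together give the continuity of elapsed time
  on which the arguments below rest.\<close>

lemma elapsed_increment:
  assumes "schedule n p r" "j < n" "0 \<le> s" "s \<le> t"
  shows elapsed_mono: "elapsed r j s \<le> elapsed r j t"
    and elapsed_lipschitz: "elapsed r j t \<le> elapsed r j s + (t - s)"
proof -
  have int: "r j integrable_on {0..t}"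
    using assms by (auto simp: schedule_def)
  then have int': "r j integrable_on {s..t}"
    by (rule integrable_on_subinterval) (use assms in auto)
  have eq: "elapsed r j s + integral {s..t} (r j) = elapsed r j t"
    unfolding elapsed_def using assms int
    by (intro Henstock_Kurzweil_Integration.integral_combine) auto
  have "0 \<le> integral {s..t} (r j)"
    using assms int' by (intro Henstock_Kurzweil_Integration.integral_nonneg) (auto simp: schedule_def)
  then show "elapsed r j s \<le> elapsed r j t"
    using eq by simp
  have "integral {s..t} (r j) \<le> integral {s..t} (\<lambda>_. 1)"
    using assms int' by (intro integral_le) (auto intro: schedule_rate_le_1)
  then show "elapsed r j t \<le> elapsed r j s + (t - s)"
    using eq assms by simp
qed

lemma elapsed_nonneg:
  assumes "schedule n p r" "j < n" "0 \<le> t"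
  shows "0 \<le> elapsed r j t"
  using elapsed_mono[of n p r j 0 t] assms by simp

lemma sum_elapsed_le:
  assumes "schedule n p r" "0 \<le> t"
  shows "(\<Sum>j<n. elapsed r j t) \<le> t"
proof -
  have int: "r j integrable_on {0..t}" if "j < n" for j
    using assms that by (auto simp: schedule_def)
  have "(\<Sum>j<n. elapsed r j t) = integral {0..t} (\<lambda>s. \<Sum>j<n. r j s)"
    unfolding elapsed_def using int by (intro Henstock_Kurzweil_Integration.integral_sum[symmetric]) auto
  also have "\<dots> \<le> integral {0..t} (\<lambda>_. 1)"
    using assms int by (intro integral_le integrable_sum) (auto simp: schedule_def)
  finally show ?thesis
    using assms by simp
qed

section \<open>Non-anticipation of executions\<close>

text \<open>A threshold counts as passed once it is reached, and there are finitely many of them. So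
  a display stays frozen for a moment, whatever the rates do; this drives the extension step of
  \<open>execution_agree\<close>.\<close>

lemma progress_right_constant:
  "\<exists>\<epsilon>>0. \<forall>y\<in>{x..x + \<epsilon>}. progress g w j y = progress g w j x"
proof -
  have "\<forall>\<^sub>F y in at_right x. \<forall>h\<in>{1..g + 1}. threshold g w j h \<le> y \<longleftrightarrow> threshold g w j h \<le> x"
  proof (intro eventually_ball_finite ballI)
    fix h
    show "\<forall>\<^sub>F y in at_right x. threshold g w j h \<le> y \<longleftrightarrow> threshold g w j h \<le> x"
    proof (cases "threshold g w j h \<le> x")
      case True
      show ?thesis
        by (rule eventually_mono[OF eventually_at_right_less[of x]]) (use True in auto)
    next
      case False
      then have "\<forall>\<^sub>F y in at_right x. y < threshold g w j h"
        by (intro eventually_at_rightI[of x "threshold g w j h"]) auto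
      then show ?thesis
        by (rule eventually_mono) (use False in auto)
    qed
  qed auto
  then obtain b where b: "b > x"
    "\<And>y. x < y \<Longrightarrow> y < b \<Longrightarrow> \<forall>h\<in>{1..g + 1}. threshold g w j h \<le> y \<longleftrightarrow> threshold g w j h \<le> x"
    unfolding eventually_at_right_field by blast
  have "progress g w j y = progress g w j x" if "y \<in> {x..x + (b - x) / 2}" for y
  proof (cases "y = x")
    case False
    then have "x < y" "y < b"
      using that b(1) by (auto simp: field_simps)
    then show ?thesis
      unfolding progress_def using b(2)
      by (intro arg_cong2[where f = "(/)"] sum.cong refl) auto
  qed simp
  moreover have "(b - x) / 2 > 0"
    using b(1) by simp
  ultimately show ?thesis
    by blast
qed

text \<open>
  Non-anticipation: the bars of job \<open>k\<close> beyond an elapsed time of \<open>x\<close> influence a run only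
  after job \<open>k\<close> has received \<open>x\<close>.
\<close>

lemma execution_agree:
  assumes exec: "execution g n p w \<pi> r" and exec': "execution g n p' w' \<pi> r'"
    and pos: "\<And>j. j < n \<Longrightarrow> 0 < p j"
    and progress_eq: "\<And>j e. j < n \<Longrightarrow> 0 \<le> e \<Longrightarrow> j = k \<longrightarrow> e < x \<Longrightarrow>
      progress g w j (e / p j) = progress g w' j (e / p' j)"
    and k: "k < n" and T: "0 \<le> T" "elapsed r k T < x"
  shows "\<forall>j<n. elapsed r j T = elapsed r' j T"
proof -
  have sched: "schedule n p r" "schedule n p' r'"
    and rates: "\<And>t j. 0 \<le> t \<Longrightarrow> j < n \<Longrightarrow> r j t = \<pi> t (history g n p w r t) j"
      "\<And>t j. 0 \<le> t \<Longrightarrow> j < n \<Longrightarrow> r' j t = \<pi> t (history g n p' w' r' t) j"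
    using exec exec' by (auto simp: execution_def)
  \<comment> \<open>\<open>Z\<close> collects the times up to which the two runs agree. Agreement
    passes to the supremum by continuity, and if the supremum were below \<open>T\<close>, it could
    be extended further.\<close>
  define Z where "Z = {t\<in>{0..T}. \<forall>s\<in>{0..t}. \<forall>j<n. elapsed r j s = elapsed r' j s}"
  have below_x: "elapsed r k s < x" if "0 \<le> s" "s \<le> T" for s
    using elapsed_mono[OF sched(1) k that] T by simp
  have "0 \<in> Z"
    using T by (auto simp: Z_def)
  have bdd: "bdd_above Z"
    by (auto simp: Z_def intro!: bdd_aboveI[of _ T])
  define t where "t = Sup Z"
  have t: "0 \<le> t" "t \<le> T"
    using \<open>0 \<in> Z\<close> bdd unfolding t_def
    by (auto intro: cSup_upper intro!: cSup_least) (auto simp: Z_def)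
  have before: "elapsed r j s = elapsed r' j s" if "0 \<le> s" "s < t" "j < n" for s j
  proof -
    have "\<exists>u\<in>Z. s < u"
      using \<open>s < t\<close> \<open>0 \<in> Z\<close> bdd unfolding t_def by (subst (asm) less_cSup_iff) auto
    then obtain u where "u \<in> Z" "s < u"
      by blast
    then show ?thesis
      using that by (auto simp: Z_def)
  qed
  have at: "elapsed r j t = elapsed r' j t" if "j < n" for j
  proof (rule ccontr)
    assume neq: "elapsed r j t \<noteq> elapsed r' j t"
    then have "t \<noteq> 0"
      by auto
    then have "t > 0"
      using t by simp
    \<comment> \<open>From \<open>s\<close> on, both elapsed times grow from a common value by at
      least 0 and at most \<open>d / 2\<close>, which cannot produce a difference of
      \<open>d\<close>.\<close>
    define d where "d = \<bar>elapsed r j t - elapsed r' j t\<bar>"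
    define s where "s = max 0 (t - d / 2)"
    have "d > 0"
      using neq by (simp add: d_def)
    then have s: "0 \<le> s" "s < t" "t - s \<le> d / 2"
      using \<open>t > 0\<close> by (auto simp: s_def max_def)
    have "elapsed r j s = elapsed r' j s"
      using before s that by simp
    then show False
      using elapsed_increment[OF sched(1) that s(1), of t]
        elapsed_increment[OF sched(2) that s(1), of t] s \<open>d > 0\<close>
      by (auto simp: d_def)
  qed
  have upto: "elapsed r j s = elapsed r' j s" if "0 \<le> s" "s \<le> t" "j < n" for s j
    using before at that by (cases "s = t") auto
  have "t = T"
  proof (rule ccontr)
    assume "t \<noteq> T"
    then have "t < T"
      using t by simp
    \<comment> \<open>A window of elapsed time in which the display is frozen and job
      \<open>k\<close> stays below \<open>x\<close>. The factor \<open>p j\<close> converts progress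
      into processing; half the remaining distance to \<open>x\<close> keeps that bound
      strict.\<close>
    have "\<exists>\<epsilon>>0. \<forall>e\<in>{elapsed r j t..elapsed r j t + \<epsilon>}.
        progress g w j (e / p j) = progress g w j (elapsed r j t / p j) \<and> (j = k \<longrightarrow> e < x)"
      if j: "j < n" for j
    proof -
      obtain \<epsilon> where \<epsilon>: "\<epsilon> > 0" "\<And>y. y \<in> {elapsed r j t / p j..elapsed r j t / p j + \<epsilon>} \<Longrightarrow>
          progress g w j y = progress g w j (elapsed r j t / p j)"
        using progress_right_constant by blast
      have const: "progress g w j (e / p j) = progress g w j (elapsed r j t / p j)"
        if "e \<in> {elapsed r j t..elapsed r j t + \<epsilon> * p j}" for e
        using that pos[OF j] by (intro \<epsilon>) (auto simp: field_simps)
      define \<eta> where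
        "\<eta> = (if j = k then min (\<epsilon> * p j) ((x - elapsed r k t) / 2) else \<epsilon> * p j)"
      have "\<eta> > 0"
        using \<epsilon>(1) pos[OF j] below_x[OF t] by (auto simp: \<eta>_def)
      have \<eta>_le: "\<eta> \<le> \<epsilon> * p j"
        by (simp add: \<eta>_def)
      have less_x: "elapsed r j t + \<eta> < x" if "j = k"
      proof -
        have "\<eta> \<le> (x - elapsed r j t) / 2"
          using that min.cobounded2[of "\<epsilon> * p j" "(x - elapsed r k t) / 2"] by (simp add: \<eta>_def)
        then show ?thesis
          using below_x[OF t] that by (simp add: field_simps)
      qed
      show ?thesis
      proof (intro exI[of _ \<eta>] conjI ballI impI)
        fix e
        assume e: "e \<in> {elapsed r j t..elapsed r j t + \<eta>}"
        then show "progress g w j (e / p j) = progress g w j (elapsed r j t / p j)"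
          using \<eta>_le by (intro const) simp
        show "e < x" if "j = k"
          using less_x[OF that] e by simp
      qed fact
    qed
    then have "\<forall>j\<in>{..<n}. \<exists>\<epsilon>. \<epsilon> > 0 \<and> (\<forall>e\<in>{elapsed r j t..elapsed r j t + \<epsilon>}.
        progress g w j (e / p j) = progress g w j (elapsed r j t / p j) \<and> (j = k \<longrightarrow> e < x))"
      by simp
    from bchoice[OF this] obtain \<delta> where \<delta>: "\<forall>j\<in>{..<n}. \<delta> j > 0 \<and>
        (\<forall>e\<in>{elapsed r j t..elapsed r j t + \<delta> j}.
          progress g w j (e / p j) = progress g w j (elapsed r j t / p j) \<and> (j = k \<longrightarrow> e < x))"
      by blast
    define \<epsilon> where "\<epsilon> = Min (insert (T - t) (\<delta> ` {..<n}))"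
    have \<epsilon>: "\<epsilon> > 0" "\<epsilon> \<le> T - t" "\<And>j. j < n \<Longrightarrow> \<epsilon> \<le> \<delta> j"
      using \<delta> \<open>t < T\<close> by (auto simp: \<epsilon>_def)
    \<comment> \<open>This breaks the circle between rates and displays. By the Lipschitz bound both
      runs stay inside the window during the next \<open>\<epsilon>\<close> units of time, so their
      displays agree before anything is known about their rates. Equal histories then force equal
      rates beyond \<open>t\<close>.\<close>
    have display: "progress g w j (elapsed r j s / p j) = progress g w' j (elapsed r' j s / p' j)"
      if "0 \<le> s" "s \<le> t + \<epsilon>" "j < n" for s j
    proof (cases "s \<le> t")
      case True
      then have "elapsed r' j s = elapsed r j s"
        using upto that by simp
      then show ?thesis
        using progress_eq[of j "elapsed r j s"] that elapsed_nonneg[OF sched(1), of j s]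
          below_x[of s] True t by auto
    next
      case False
      have "elapsed r j s \<in> {elapsed r j t..elapsed r j t + \<delta> j}"
        using elapsed_increment[OF sched(1) \<open>j < n\<close> t(1), of s] False that \<epsilon>(3)[of j] by auto
      then have 1: "progress g w j (elapsed r j s / p j) = progress g w j (elapsed r j t / p j)"
        using \<delta> \<open>j < n\<close> by blast
      have "elapsed r' j s \<in> {elapsed r j t..elapsed r j t + \<delta> j}"
        using elapsed_increment[OF sched(2) \<open>j < n\<close> t(1), of s] at[OF \<open>j < n\<close>] False that \<epsilon>(3)[of j]
        by auto
      then have 2: "progress g w j (elapsed r' j s / p j) = progress g w j (elapsed r j t / p j)"
        "j = k \<longrightarrow> elapsed r' j s < x"
        using \<delta> \<open>j < n\<close> by blast+
      show ?thesis
        using 1 2 progress_eq[of j "elapsed r' j s"] that elapsed_nonneg[OF sched(2), of j s] by simp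
    qed
    have history_eq: "history g n p w r s = history g n p' w' r' s" if "0 \<le> s" "s \<le> t + \<epsilon>" for s
      unfolding history_def using display that by (intro restrict_ext) auto
    have rates_eq: "r j s = r' j s" if "0 \<le> s" "s \<le> t + \<epsilon>" "j < n" for s j
      using rates that history_eq by simp
    have "elapsed r j s = elapsed r' j s" if "0 \<le> s" "s \<le> t + \<epsilon>" "j < n" for s j
      unfolding elapsed_def using rates_eq that by (intro Henstock_Kurzweil_Integration.integral_cong) auto
    then have "t + \<epsilon> \<in> Z"
      using t \<epsilon> by (auto simp: Z_def)
    then have "t + \<epsilon> \<le> t"
      unfolding t_def using bdd by (rule cSup_upper)
    then show False
      using \<epsilon>(1) by simp
  qed
  then show ?thesis
    using at by simp
qed

text \<open>Elapsed times are continuous, so rational times suffice; they make the event measurable.\<close>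

definition follows :: "real \<Rightarrow> nat \<Rightarrow> nat \<Rightarrow> rates \<Rightarrow> bool" where
  "follows x k l r \<longleftrightarrow> (\<exists>t\<in>\<rat>. 0 \<le> t \<and> elapsed r k t < x \<and> x < elapsed r l t)"

text \<open>By monotonicity, each of the two witnessing times would have to precede the
  other.\<close>

lemma not_follows_both:
  assumes "schedule n p r" "k < n" "l < n" "follows x k l r"
  shows "\<not> follows x l k r"
proof
  assume "follows x l k r"
  then obtain s where s: "0 \<le> s" "elapsed r l s < x" "x < elapsed r k s"
    by (auto simp: follows_def)
  obtain t where t: "0 \<le> t" "elapsed r k t < x" "x < elapsed r l t"
    using assms by (auto simp: follows_def)
  show False
    using elapsed_mono[OF assms(1) \<open>k < n\<close> s(1), of t] elapsed_mono[OF assms(1) \<open>l < n\<close> t(1), of s] s t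
    by linarith
qed

text \<open>At a witnessing time job \<open>k\<close> is still below \<open>x\<close>, which is when
  \<open>execution_agree\<close> identifies all elapsed times. It is used in both directions, as the
  witness may come from either run.\<close>

lemma follows_execution_cong:
  assumes exec: "execution g n p w \<pi> r" and exec': "execution g n p' w' \<pi> r'"
    and pos: "\<And>j. j < n \<Longrightarrow> 0 < p j" "\<And>j. j < n \<Longrightarrow> 0 < p' j"
    and progress_eq: "\<And>j e. j < n \<Longrightarrow> 0 \<le> e \<Longrightarrow> j = k \<longrightarrow> e < x \<Longrightarrow>
      progress g w j (e / p j) = progress g w' j (e / p' j)"
    and "k < n" "l < n"
  shows "follows x k l r \<longleftrightarrow> follows x k l r'"
proof
  show "follows x k l r \<Longrightarrow> follows x k l r'"
    using execution_agree[where x = x, OF exec exec' pos(1) progress_eq \<open>k < n\<close>] \<open>k < n\<close> \<open>l < n\<close>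
    unfolding follows_def by (metis (no_types, lifting))
  show "follows x k l r' \<Longrightarrow> follows x k l r"
    using execution_agree[where x = x, OF exec' exec pos(2) progress_eq[symmetric] \<open>k < n\<close>]
      \<open>k < n\<close> \<open>l < n\<close>
    unfolding follows_def by (metis (no_types, lifting))
qed

section \<open>Cost of an arbitrary schedule and of the optimum\<close>

text \<open>Passes from a bound on all pairs of times at which two jobs are complete to their
  completion times. One infimum is taken at a time, the other summand being moved across by
  truncated subtraction, which finiteness of \<open>B\<close> makes reversible.\<close>

lemma le_add_INF_ennreal:
  fixes B :: ennreal
  assumes "B < \<top>" "\<And>s t. s \<in> X \<Longrightarrow> t \<in> Y \<Longrightarrow> B \<le> f s + h t"
  shows "B \<le> (INF s\<in>X. f s) + (INF t\<in>Y. h t)"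
proof -
  have "B - (INF s\<in>X. f s) \<le> h t" if "t \<in> Y" for t
  proof -
    have "B - h t \<le> (INF s\<in>X. f s)"
      using assms that by (intro INF_greatest) (auto simp: ennreal_minus_le_iff add.commute)
    then show ?thesis
      using assms(1) by (auto simp: ennreal_minus_le_iff add.commute)
  qed
  then have "B - (INF s\<in>X. f s) \<le> (INF t\<in>Y. h t)"
    by (intro INF_greatest)
  then show ?thesis
    using assms(1) by (auto simp: ennreal_minus_le_iff)
qed

text \<open>
  If the short job \<open>l\<close> finishes first although it did not pass \<open>x\<close> before job \<open>k\<close>, then job
  \<open>k\<close> has already received \<open>x\<close> by then; if the long job \<open>k\<close> finishes first, this costs \<open>d\<close>.
\<close>

lemma total_completion_time_ge:
  assumes sched: "schedule 2 p r"
    and kl: "{k, l} = {0, 1}" "p k = 1 + d" "p l = 1"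
    and x: "0 \<le> x" "x < 1" "x \<le> d"
  shows "ennreal (3 + d) + ennreal x * indicator {r. \<not> follows x k l r} r \<le> total_completion_time 2 p r"
proof -
  have k2: "k < 2" "l < 2" "k \<noteq> l"
    using kl(1) by (auto simp: doubleton_eq_iff)
  define y where "y = (if follows x k l r then 0 else x)"
  have tot: "elapsed r k t + elapsed r l t \<le> t" if "0 \<le> t" for t
    using sum_elapsed_le[OF sched that] kl(1)
    by (auto simp: doubleton_eq_iff numeral_2_eq_2)
  have main: "3 + d + y \<le> s + t"
    if s: "0 \<le> s" "1 + d \<le> elapsed r k s" and t: "0 \<le> t" "1 \<le> elapsed r l t" for s t
  proof (cases "s \<le> t")
    \<comment> \<open>The long job finishes first: \<open>s >= 1 + d\<close> and
      \<open>t >= 2 + d\<close>, while \<open>y <= x <= d\<close>.\<close>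
    case True
    have "elapsed r k s \<le> elapsed r k t"
      by (rule elapsed_mono[OF sched k2(1) s(1) True])
    then show ?thesis
      using tot[OF s(1)] tot[OF t(1)] s t elapsed_nonneg[OF sched k2(2) s(1)] x by (simp add: y_def)
  next
    case False
    have "elapsed r l t \<le> elapsed r l s"
      by (rule elapsed_mono[OF sched k2(2) t(1)]) (use False in simp)
    \<comment> \<open>The short job finishes first: \<open>s >= 2 + d\<close> and
      \<open>t >= 1 + elapsed r k t\<close>, so the penalty \<open>y\<close> must come from what job
      \<open>k\<close> has received by time \<open>t\<close>.\<close>
    moreover have "y \<le> elapsed r k t"
    proof (rule ccontr)
      assume neg: "\<not> y \<le> elapsed r k t"
      then have *: "y = x" "\<not> follows x k l r" "elapsed r k t < x"
        using elapsed_nonneg[OF sched k2(1) t(1)] by (auto simp: y_def split: if_splits)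
      \<comment> \<open>By the Lipschitz bound job \<open>k\<close> is still below \<open>x\<close>
        at time \<open>q\<close>, whereas job \<open>l\<close> has at least \<open>1 > x\<close>; so
        \<open>q\<close> witnesses \<open>follows\<close>.\<close>
      obtain q where q: "q \<in> \<rat>" "t < q" "q < t + (x - elapsed r k t)"
        using Rats_dense_in_real[of t "t + (x - elapsed r k t)"] * by auto
      have "elapsed r k q < x"
        using elapsed_lipschitz[OF sched k2(1) t(1), of q] q by simp
      moreover have "x < elapsed r l q"
        using elapsed_mono[OF sched k2(2) t(1), of q] q t x by simp
      ultimately show False
        using * q t by (auto simp: follows_def)
    qed
    ultimately show ?thesis
      using tot[OF s(1)] tot[OF t(1)] s t by linarith
  qed
  have "ennreal (3 + d + y) \<le> completion_time p r k + completion_time p r l"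
    unfolding completion_time_def kl
    by (intro le_add_INF_ennreal) (use main in \<open>auto simp flip: ennreal_plus intro!: ennreal_leI\<close>)
  also have "\<dots> = total_completion_time 2 p r"
    using kl(1) by (auto simp: total_completion_time_def numeral_2_eq_2 doubleton_eq_iff add.commute)
  also have "ennreal (3 + d + y) = ennreal (3 + d) + ennreal x * indicator {r. \<not> follows x k l r} r"
    using x by (auto simp: y_def simp flip: ennreal_plus)
  finally show ?thesis .
qed

text \<open>Running the short job first gives the completion times 1 and
  \<open>2 + d\<close>.\<close>

lemma OPT_le:
  assumes kl: "{k, l} = {0, 1}" "p k = 1 + d" "p l = 1" and d: "0 \<le> d"
  shows "OPT 2 p \<le> ennreal (3 + d)"
proof -
  have k2: "k < 2" "l < 2" "k \<noteq> l"
    using kl(1) by (auto simp: doubleton_eq_iff)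
  \<comment> \<open>The intervals are half-open because \<open>schedule\<close> demands rate 0
    already at the moment of completion.\<close>
  define r :: rates where
    "r = (\<lambda>j t. if j = l then indicator {0..<1} t else indicator {1..<2 + d} t)"
  have r_l: "(r l has_integral (min t 1)) {0..t}" if "0 \<le> t" for t
  proof -
    have "((\<lambda>_. 1) has_integral (min t 1)) {0..min t 1}"
      using has_integral_const_real[of "1::real" 0 "min t 1"] that by simp
    then have "((\<lambda>s. if s \<in> {0..min t 1} then 1 else 0) has_integral (min t 1)) {0..t}"
      by (subst has_integral_restrict) auto
    then show ?thesis
      by (rule has_integral_spike_finite[where S = "{1}", rotated 2])
        (auto simp: r_def indicator_def)
  qed
  have r_k: "(r k has_integral (max 0 (min (t - 1) (1 + d)))) {0..t}" if "0 \<le> t" for t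
  proof -
    have "((\<lambda>_. 1) has_integral (max 0 (min (t - 1) (1 + d)))) {1..min t (2 + d)}"
      using has_integral_const_real[of "1::real" 1 "min t (2 + d)"] that d
      by (auto simp: min_def max_def split: if_splits)
    then have "((\<lambda>s. if s \<in> {1..min t (2 + d)} then 1 else 0) has_integral
        (max 0 (min (t - 1) (1 + d)))) {0..t}"
      by (subst has_integral_restrict) auto
    then show ?thesis
      by (rule has_integral_spike_finite[where S = "{2 + d}", rotated 2])
        (use k2 in \<open>auto simp: r_def indicator_def\<close>)
  qed
  have e_l: "elapsed r l t = min t 1" if "0 \<le> t" for t
    using r_l[OF that] by (auto simp: elapsed_def)
  have e_k: "elapsed r k t = max 0 (min (t - 1) (1 + d))" if "0 \<le> t" for t
    using r_k[OF that] by (auto simp: elapsed_def)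
  have cases: "j = k \<or> j = l" if "j < 2" for j
    using that kl(1) by (auto simp: doubleton_eq_iff)
  have rates: "r l t = indicator {0..<1} t" "r k t = indicator {1..<2 + d} t" for t
    using k2(3) by (simp_all add: r_def)
  have sched: "schedule 2 p r"
    unfolding schedule_def
  proof (intro conjI allI impI)
    show "r j integrable_on {0..t}" if "j < 2" "0 \<le> t" for j t
      using cases[OF \<open>j < 2\<close>] r_l[OF \<open>0 \<le> t\<close>] r_k[OF \<open>0 \<le> t\<close>] by (auto simp: integrable_on_def)
    show "0 \<le> r j t" for j t
      by (simp add: r_def)
    show "r j t = 0" if "0 \<le> t" "j < 2" "p j \<le> elapsed r j t" for j t
      using cases[OF \<open>j < 2\<close>] that d
      by (auto simp: e_l e_k kl rates indicator_def min_def max_def split: if_splits)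
    show "(\<Sum>j<2. r j t) \<le> 1" if "0 \<le> t" for t
      using kl(1) by (auto simp: numeral_2_eq_2 r_def indicator_def doubleton_eq_iff)
  qed
  have "completion_time p r l \<le> ennreal 1"
    unfolding completion_time_def by (intro INF_lower) (auto simp: e_l kl)
  moreover have "completion_time p r k \<le> ennreal (2 + d)"
    unfolding completion_time_def using d by (intro INF_lower) (auto simp: e_k kl)
  ultimately have "completion_time p r l + completion_time p r k \<le> ennreal 1 + ennreal (2 + d)"
    by (rule add_mono)
  also have "\<dots> = ennreal (3 + d)"
    using d by (simp flip: ennreal_plus ennreal_1)
  also have "completion_time p r l + completion_time p r k = total_completion_time 2 p r"
    using kl(1) by (auto simp: total_completion_time_def numeral_2_eq_2 doubleton_eq_iff add.commute)
  finally show ?thesis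
    unfolding OPT_def using sched by (intro INF_lower2[of r]) auto
qed

section \<open>Likelihood ratios of Poisson processes\<close>

abbreviation exp_law :: "real \<Rightarrow> real measure" where
  "exp_law l \<equiv> density lborel (exponential_density l)"

text \<open>
  Read the gaps \<open>u i\<close>, \<open>i \<in> set is\<close>, in the order of \<open>is\<close>: the points of \<open>u\<close> and the points
  of \<open>u'\<close> stretched by \<open>c\<close> agree on \<open>[0, z]\<close>.
\<close>

primrec agree_upto :: "real \<Rightarrow> 'i list \<Rightarrow> real \<Rightarrow> ('i \<Rightarrow> real) \<Rightarrow> ('i \<Rightarrow> real) \<Rightarrow> bool" where
  "agree_upto c [] z u u' \<longleftrightarrow> True"
| "agree_upto c (i # is) z u u' \<longleftrightarrow>
     z < u i \<and> z < c * u' i \<or> u i = c * u' i \<and> agree_upto c is (z - u i) u u'"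

text \<open>
  The likelihood ratio on \<open>[0, y]\<close> of a Poisson process of rate \<open>c * l\<close> against one of rate \<open>l\<close>,
  both stopped after \<open>length is\<close> points.
\<close>

primrec likelihood :: "real \<Rightarrow> real \<Rightarrow> 'i list \<Rightarrow> real \<Rightarrow> ('i \<Rightarrow> real) \<Rightarrow> real" where
  "likelihood c l [] y u = 1"
| "likelihood c l (i # is) y u =
     (if y < u i then exp (- ((c - 1) * l * y))
      else c * exp (- ((c - 1) * l * u i)) * likelihood c l is (y - u i) u)"

lemma agree_upto_cong:
  assumes "\<And>i. i \<in> set is \<Longrightarrow> u i = v i" "\<And>i. i \<in> set is \<Longrightarrow> u' i = v' i"
  shows "agree_upto c is z u u' \<longleftrightarrow> agree_upto c is z v v'"
  using assms by (induction "is" arbitrary: z) auto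

lemma likelihood_cong:
  assumes "\<And>i. i \<in> set is \<Longrightarrow> u i = v i"
  shows "likelihood c l is y u = likelihood c l is y v"
  using assms by (induction "is" arbitrary: y) auto

lemma likelihood_nonneg: "0 \<le> c \<Longrightarrow> 0 \<le> likelihood c l is y u"
  by (induction "is" arbitrary: y) auto

text \<open>The horizon \<open>f x\<close> may vary with \<open>x\<close> because the recursion
  lowers it by the gap just read.\<close>

lemma likelihood_measurable:
  assumes "f \<in> borel_measurable M" "h \<in> measurable M (Pi\<^sub>M I (\<lambda>_. exp_law l'))" "set is \<subseteq> I"
  shows "(\<lambda>x. likelihood c l is (f x) (h x)) \<in> borel_measurable M"
  using assms
proof (induction "is" arbitrary: f)
  case (Cons i "is")
  have "(\<lambda>x. h x i) \<in> measurable M (exp_law l')"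
    using measurable_compose[OF Cons.prems(2) measurable_component_singleton[of i I]] Cons.prems(3)
    by simp
  then have [measurable]: "(\<lambda>x. h x i) \<in> borel_measurable M"
    by simp
  note [measurable] = Cons.prems(1)
  have [measurable]: "(\<lambda>x. likelihood c l is (f x - h x i) (h x)) \<in> borel_measurable M"
    using Cons.prems by (intro Cons.IH) auto
  show ?case
    by simp
qed simp

text \<open>Since \<open>c\<^sup>2 - 1 = 2 * (c - 1) + (c - 1)\<^sup>2\<close>, squaring the ratio
  for \<open>c\<close> gives the ratio for \<open>c\<^sup>2\<close> up to an exponential factor.
  Inequality enters only when the gaps run out before the horizon. As the ratio for
  \<open>c\<^sup>2\<close> has mean 1, this bounds the second moment.\<close>

lemma likelihood_square:
  assumes "0 < c" "0 \<le> l" "0 \<le> y"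
  shows "(likelihood c l is y u)\<^sup>2 \<le> exp ((c - 1)\<^sup>2 * l * y) * likelihood (c\<^sup>2) l is y u"
  using \<open>0 \<le> y\<close>
proof (induction "is" arbitrary: y)
  case Nil
  then show ?case
    using assms by simp
next
  case (Cons i "is")
  show ?case
  proof (cases "y < u i")
    case True
    then show ?thesis
      by (simp add: power2_eq_square algebra_simps flip: exp_double exp_add)
  next
    case False
    have "(likelihood c l (i # is) y u)\<^sup>2
        = c\<^sup>2 * exp (- (2 * (c - 1) * l * u i)) * (likelihood c l is (y - u i) u)\<^sup>2"
      using False by (simp add: power_mult_distrib algebra_simps flip: exp_double)
    also have "\<dots> \<le> c\<^sup>2 * exp (- (2 * (c - 1) * l * u i)) *
        (exp ((c - 1)\<^sup>2 * l * (y - u i)) * likelihood (c\<^sup>2) l is (y - u i) u)"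
      using False by (intro mult_left_mono Cons.IH) auto
    also have "\<dots> = c\<^sup>2 * (exp (- (2 * (c - 1) * l * u i)) * exp ((c - 1)\<^sup>2 * l * (y - u i))) *
        likelihood (c\<^sup>2) l is (y - u i) u"
      by (simp add: mult_ac)
    also have "exp (- (2 * (c - 1) * l * u i)) * exp ((c - 1)\<^sup>2 * l * (y - u i)) =
        exp ((c - 1)\<^sup>2 * l * y) * exp (- ((c\<^sup>2 - 1) * l * u i))"
      by (simp add: power2_eq_square algebra_simps flip: exp_add)
    also have "c\<^sup>2 * (exp ((c - 1)\<^sup>2 * l * y) * exp (- ((c\<^sup>2 - 1) * l * u i))) *
        likelihood (c\<^sup>2) l is (y - u i) u = exp ((c - 1)\<^sup>2 * l * y) * likelihood (c\<^sup>2) l (i # is) y u"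
      using False by (simp add: mult_ac)
    finally show ?thesis .
  qed
qed

section \<open>Exponential gaps and the change of measure\<close>

lemma AE_exp_law_pos: "AE s in exp_law l. 0 < s"
proof -
  have "AE s in lborel. s \<noteq> (0::real)"
    by (rule AE_lborel_singleton)
  then show ?thesis
    by (subst AE_density) (auto elim!: eventually_mono simp: exponential_density_def split: if_splits)
qed

lemma AE_PiM_exp_law_pos:
  assumes "0 < l" "finite I"
  shows "AE u in Pi\<^sub>M I (\<lambda>_. exp_law l). u \<in> (\<Pi>\<^sub>E i\<in>I. {0<..})"
proof -
  have "AE u in Pi\<^sub>M I (\<lambda>_. exp_law l). \<forall>i\<in>I. 0 < u i"
    using assms by (intro AE_finite_allI AE_PiM_component AE_exp_law_pos prob_space_exponential_density)
  moreover have "AE u in Pi\<^sub>M I (\<lambda>_. exp_law l). u \<in> space (Pi\<^sub>M I (\<lambda>_. exp_law l))"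
    by (rule AE_space)
  ultimately show ?thesis
    by eventually_elim (auto simp: space_PiM)
qed

lemma emeasure_exp_law_greaterThan:
  assumes "0 < l" "0 \<le> a"
  shows "emeasure (exp_law l) {a<..} = ennreal (exp (- (l * a)))"
proof -
  interpret prob_space "exp_law l"
    by (rule prob_space_exponential_density) fact
  have "emeasure (exp_law l) (space (exp_law l) - {..a}) = 1 - emeasure (exp_law l) {..a}"
    by (subst emeasure_compl) (auto simp: emeasure_space_1[simplified])
  also have "space (exp_law l) - {..a} = {a<..}"
    by auto
  also have "emeasure (exp_law l) {..a} = ennreal (1 - exp (- a * l))"
    using assms by (simp add: emeasure_erlang_density erlang_CDF_0 mult.commute)
  also have "1 - ennreal (1 - exp (- a * l)) = ennreal (exp (- (l * a)))"
    using assms by (subst ennreal_1[symmetric], subst ennreal_minus) (auto simp: mult.commute)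
  finally show ?thesis .
qed

text \<open>Under the weight the gaps in \<open>is\<close> produce points of rate
  \<open>c * l\<close> up to \<open>z / c\<close>; stretching by \<open>c\<close> restores rate
  \<open>l\<close> up to \<open>z\<close>. Gaps in \<open>J\<close> are common to both sides. There
  are two integrands because one event is described in two instances. The induction conditions on
  the first gap, which shortens the horizon for the others.\<close>

lemma change_of_measure:
  fixes f1 f2 :: "('i \<Rightarrow> real) \<Rightarrow> ennreal"
  assumes l: "0 < l" and c: "0 < c" and "finite J"
    and "distinct is" "set is \<inter> J = {}" "0 \<le> z"
    and "f1 \<in> borel_measurable (Pi\<^sub>M (set is \<union> J) (\<lambda>_. exp_law l))"
    and "f2 \<in> borel_measurable (Pi\<^sub>M (set is \<union> J) (\<lambda>_. exp_law l))"
    and "\<And>u u'. u \<in> (\<Pi>\<^sub>E i\<in>set is \<union> J. {0<..}) \<Longrightarrow> u' \<in> (\<Pi>\<^sub>E i\<in>set is \<union> J. {0<..}) \<Longrightarrow>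
      agree_upto c is z u u' \<Longrightarrow> (\<And>j. j \<in> J \<Longrightarrow> u j = u' j) \<Longrightarrow> f1 u = f2 u'"
  shows "(\<integral>\<^sup>+u. f1 u \<partial>Pi\<^sub>M (set is \<union> J) (\<lambda>_. exp_law l)) =
    (\<integral>\<^sup>+u. f2 u * ennreal (likelihood c l is (z / c) u) \<partial>Pi\<^sub>M (set is \<union> J) (\<lambda>_. exp_law l))"
  using assms(4-)
proof (induction "is" arbitrary: z f1 f2)
  case Nil
  have "AE u in Pi\<^sub>M (set [] \<union> J) (\<lambda>_. exp_law l). u \<in> (\<Pi>\<^sub>E i\<in>set [] \<union> J. {0<..})"
    using l \<open>finite J\<close> by (intro AE_PiM_exp_law_pos) auto
  then show ?case
    by (intro nn_integral_cong_AE) (auto elim!: eventually_mono intro!: Nil.prems)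
next
  case (Cons i "is")
  define I where "I = set is \<union> J"
  have I: "finite I" "i \<notin> I" "set (i # is) \<union> J = insert i I"
    using Cons.prems \<open>finite J\<close> by (auto simp: I_def)
  let ?N = "Pi\<^sub>M I (\<lambda>_. exp_law l)"
  interpret E: prob_space "exp_law l"
    by (rule prob_space_exponential_density) fact
  interpret product_sigma_finite "\<lambda>_. exp_law l"
    by standard
  interpret N: prob_space ?N
    by (intro prob_space_PiM) (rule E.prob_space_axioms)
  note [measurable] = Cons.prems(4,5)[unfolded I]
  define y where "y = z / c"
  have y: "0 \<le> y" "c * y = z"
    using c Cons.prems by (auto simp: y_def)
  have upd: "(\<lambda>(s, u). u(i := s)) \<in> measurable (exp_law l \<Otimes>\<^sub>M ?N) (Pi\<^sub>M (insert i I) (\<lambda>_. exp_law l))"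
    by measurable
  have upd': "(\<lambda>u. u(i := s)) \<in> measurable ?N (Pi\<^sub>M (insert i I) (\<lambda>_. exp_law l))" for s
    by (rule measurable_fun_upd[where J = I]) auto
  have pos_upd: "u(i := s) \<in> (\<Pi>\<^sub>E i\<in>insert i I. {0<..})" if "u \<in> (\<Pi>\<^sub>E i\<in>I. {0<..})" "0 < s" for u s
    using that by (auto simp: PiE_def extensional_def)
  have AE_pos: "AE u in ?N. u \<in> (\<Pi>\<^sub>E i\<in>I. {0<..})"
    using l I(1) by (rule AE_PiM_exp_law_pos)
  \<comment> \<open>If both first gaps pass their horizons, no points lie within them, so the two
    values coincide and do not depend on these gaps. \<open>K\<close> below is the resulting common
    integral; \<open>z + 1\<close> is a mere representative.\<close>
  have eq_beyond: "f1 (u(i := s)) = f2 (u(i := s'))"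
    if "u \<in> (\<Pi>\<^sub>E i\<in>I. {0<..})" "z < s" "y < s'" for u s s'
  proof (rule Cons.prems(6))
    have "0 < s" "0 < s'"
      using that y(1) Cons.prems(3) by simp_all
    then show "u(i := s) \<in> (\<Pi>\<^sub>E i\<in>set (i # is) \<union> J. {0<..})"
      "u(i := s') \<in> (\<Pi>\<^sub>E i\<in>set (i # is) \<union> J. {0<..})"
      unfolding I(3) using pos_upd[OF that(1)] by blast+
    show "agree_upto c (i # is) z (u(i := s)) (u(i := s'))"
      using that(2,3) c by (simp add: y_def field_simps)
  qed (use I(2) in \<open>auto simp: I_def\<close>)
  define K where "K = (\<integral>\<^sup>+u. f1 (u(i := z + 1)) \<partial>?N)"
  have K2: "(\<integral>\<^sup>+u. f2 (u(i := s)) \<partial>?N) = K" if "y < s" for s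
    unfolding K_def using AE_pos
    by (intro nn_integral_cong_AE) (auto elim!: eventually_mono intro!: eq_beyond[symmetric] that)
  have K1: "(\<integral>\<^sup>+u. f1 (u(i := s)) \<partial>?N) = K" if "z < s" for s
    unfolding K2[of "y + 1", symmetric, simplified] using AE_pos
    by (intro nn_integral_cong_AE) (auto elim!: eventually_mono intro!: eq_beyond that)
  define G where "G = (\<lambda>s. \<integral>\<^sup>+u. f2 (u(i := s)) * ennreal (likelihood c l is (y - s) u) \<partial>?N)"
  have lik[measurable]:
    "(\<lambda>(s, u). likelihood c l is (y - s) u) \<in> borel_measurable (exp_law l \<Otimes>\<^sub>M ?N)"
    unfolding case_prod_beta
    by (rule likelihood_measurable[where I = I and l' = l]) (auto simp: I_def)
  have "(\<lambda>(s, u). f2 (u(i := s)) * ennreal (likelihood c l is (y - s) u))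
      \<in> borel_measurable (exp_law l \<Otimes>\<^sub>M ?N)"
    using measurable_compose[OF upd Cons.prems(5)[unfolded I]] lik
    by (simp add: case_prod_beta)
  then have "G \<in> borel_measurable (exp_law l)"
    unfolding G_def by (rule N.borel_measurable_nn_integral)
  then have [measurable]: "G \<in> borel_measurable borel"
    by simp
  \<comment> \<open>First gaps \<open>s\<close> and \<open>s / c\<close> match under stretching by
    \<open>c\<close>, so the induction hypothesis applies to the other gaps with horizon
    \<open>z - s\<close>.\<close>
  have F1: "(\<integral>\<^sup>+u. f1 (u(i := s)) \<partial>?N) = G (s / c)" if "0 < s" "s \<le> z" for s
  proof -
    have "(\<integral>\<^sup>+u. f1 (u(i := s)) \<partial>Pi\<^sub>M (set is \<union> J) (\<lambda>_. exp_law l)) =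
      (\<integral>\<^sup>+u. f2 (u(i := s / c)) * ennreal (likelihood c l is ((z - s) / c) u)
        \<partial>Pi\<^sub>M (set is \<union> J) (\<lambda>_. exp_law l))"
    proof (rule Cons.IH)
      show "(\<lambda>u. f1 (u(i := s))) \<in> borel_measurable (Pi\<^sub>M (set is \<union> J) (\<lambda>_. exp_law l))"
        unfolding I_def[symmetric] by (rule measurable_compose[OF upd' Cons.prems(4)[unfolded I]])
      show "(\<lambda>u. f2 (u(i := s / c))) \<in> borel_measurable (Pi\<^sub>M (set is \<union> J) (\<lambda>_. exp_law l))"
        unfolding I_def[symmetric] by (rule measurable_compose[OF upd' Cons.prems(5)[unfolded I]])
      fix u u'
      assume u: "u \<in> (\<Pi>\<^sub>E i\<in>set is \<union> J. {0<..})" "u' \<in> (\<Pi>\<^sub>E i\<in>set is \<union> J. {0<..})"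
        "agree_upto c is (z - s) u u'" "\<And>j. j \<in> J \<Longrightarrow> u j = u' j"
      show "f1 (u(i := s)) = f2 (u'(i := s / c))"
      proof (rule Cons.prems(6))
        have "0 < s / c"
          using that c by simp
        then show "u(i := s) \<in> (\<Pi>\<^sub>E i\<in>set (i # is) \<union> J. {0<..})"
          "u'(i := s / c) \<in> (\<Pi>\<^sub>E i\<in>set (i # is) \<union> J. {0<..})"
          unfolding I(3) using pos_upd[OF u(1)[folded I_def]] pos_upd[OF u(2)[folded I_def]] that
          by blast+
        have "agree_upto c is (z - s) (u(i := s)) (u'(i := s / c))"
          by (subst agree_upto_cong[of _ _ u _ u']) (use u(3) Cons.prems(1) in auto)
        then show "agree_upto c (i # is) z (u(i := s)) (u'(i := s / c))"
          using c by simp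
        show "(u(i := s)) j = (u'(i := s / c)) j" if "j \<in> J" for j
          using u(4)[OF that] that I(2) by (auto simp: I_def)
      qed
    qed (use Cons.prems that in auto)
    then show ?thesis
      by (simp add: G_def I_def y_def diff_divide_distrib)
  qed
  have "(\<integral>\<^sup>+u. f1 u \<partial>Pi\<^sub>M (insert i I) (\<lambda>_. exp_law l)) =
      (\<integral>\<^sup>+s. (\<integral>\<^sup>+u. f1 (u(i := s)) \<partial>?N) \<partial>exp_law l)"
    by (rule product_nn_integral_insert_rev) (use I in auto)
  \<comment> \<open>Split at the horizon; a first gap of at most 0 has probability 0.\<close>
  also have "\<dots> = (\<integral>\<^sup>+s. K * indicator {z<..} s + G (s / c) * indicator {0<..z} s \<partial>exp_law l)"
    by (intro nn_integral_cong_AE eventually_mono[OF AE_exp_law_pos]) (auto simp: K1 F1 indicator_def)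
  also have "\<dots> = K * ennreal (exp (- (l * z))) + (\<integral>\<^sup>+s. G (s / c) * indicator {0<..z} s \<partial>exp_law l)"
    using l Cons.prems(3) by (subst nn_integral_add)
      (auto simp: nn_integral_cmult_indicator emeasure_exp_law_greaterThan)
  also have "(\<integral>\<^sup>+s. G (s / c) * indicator {0<..z} s \<partial>exp_law l) =
      (\<integral>\<^sup>+s. ennreal (exponential_density l s) * (G (s / c) * indicator {0<..z} s) \<partial>lborel)"
    by (subst nn_integral_density) auto
  \<comment> \<open>Substituting \<open>c * s\<close> for \<open>s\<close> turns the density of the
    first gap into the density at \<open>s\<close> times the likelihood factor of one point.\<close>
  also have "\<dots> = ennreal c *
      (\<integral>\<^sup>+s. ennreal (exponential_density l (c * s)) * (G s * indicator {0<..z} (c * s)) \<partial>lborel)"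
    using c by (subst nn_integral_real_affine[where c = c and t = 0]) auto
  also have "\<dots> = (\<integral>\<^sup>+s. ennreal (exponential_density l s) *
      (ennreal (c * exp (- ((c - 1) * l * s))) * G s * indicator {0<..y} s) \<partial>lborel)"
  proof (subst nn_integral_cmult[symmetric], measurable, intro nn_integral_cong)
    fix s :: real
    show "ennreal c * (ennreal (exponential_density l (c * s)) * (G s * indicator {0<..z} (c * s))) =
      ennreal (exponential_density l s) *
        (ennreal (c * exp (- ((c - 1) * l * s))) * G s * indicator {0<..y} s)"
    proof (cases "0 < s \<and> s \<le> y")
      case True
      then have ind: "c * s \<in> {0<..z}" "s \<in> {0<..y}"
        using c by (auto simp: y_def field_simps)
      have "\<not> c * s < 0"
        using True c by (simp add: not_less)
      then have "c * exponential_density l (c * s) = exponential_density l s * (c * exp (- ((c - 1) * l * s)))"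
        using True by (simp add: exponential_density_def algebra_simps flip: exp_add)
      then have "ennreal c * ennreal (exponential_density l (c * s)) =
        ennreal (exponential_density l s) * ennreal (c * exp (- ((c - 1) * l * s)))"
        using c l by (simp add: exponential_density_nonneg flip: ennreal_mult)
      then show ?thesis
        using ind by (simp flip: mult.assoc)
    next
      case False
      then have "c * s \<notin> {0<..z}" "s \<notin> {0<..y}"
        using c by (auto simp: y_def field_simps zero_less_mult_iff)
      then show ?thesis
        by simp
    qed
  qed
  also have "\<dots> = (\<integral>\<^sup>+s. ennreal (c * exp (- ((c - 1) * l * s))) * G s * indicator {0<..y} s \<partial>exp_law l)"
    by (subst nn_integral_density) auto
  \<comment> \<open>Because \<open>z = c * y\<close>, the tail beyond \<open>z\<close> is the tail
    beyond \<open>y\<close> times the likelihood of having no point up to \<open>y\<close>.\<close>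
  also have "K * ennreal (exp (- (l * z))) =
      (\<integral>\<^sup>+s. (K * ennreal (exp (- ((c - 1) * l * y)))) * indicator {y<..} s \<partial>exp_law l)"
    using l y by (subst nn_integral_cmult_indicator)
      (auto simp: emeasure_exp_law_greaterThan mult.assoc algebra_simps simp flip: ennreal_mult exp_add)
  also have "\<dots> + (\<integral>\<^sup>+s. ennreal (c * exp (- ((c - 1) * l * s))) * G s * indicator {0<..y} s \<partial>exp_law l)
      = (\<integral>\<^sup>+s. (K * ennreal (exp (- ((c - 1) * l * y)))) * indicator {y<..} s +
          ennreal (c * exp (- ((c - 1) * l * s))) * G s * indicator {0<..y} s \<partial>exp_law l)"
    by (subst nn_integral_add) auto
  also have "\<dots> = (\<integral>\<^sup>+s. (\<integral>\<^sup>+u. f2 (u(i := s)) *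
      ennreal (likelihood c l (i # is) y (u(i := s))) \<partial>?N) \<partial>exp_law l)"
  proof (rule nn_integral_cong_AE, rule eventually_mono[OF AE_exp_law_pos])
    fix s :: real
    assume "0 < s"
    have f2_meas: "(\<lambda>u. f2 (u(i := s))) \<in> borel_measurable ?N"
      by (rule measurable_compose[OF upd' Cons.prems(5)[unfolded I]])
    have lik_upd: "likelihood c l is (y - s) (u(i := s)) = likelihood c l is (y - s) u" for u
      using Cons.prems(1) by (intro likelihood_cong) auto
    have lik_meas: "(\<lambda>u. likelihood c l is (y - s) u) \<in> borel_measurable ?N"
      by (rule likelihood_measurable[where I = I and l' = l]) (auto simp: I_def)
    show "(K * ennreal (exp (- ((c - 1) * l * y)))) * indicator {y<..} s +
          ennreal (c * exp (- ((c - 1) * l * s))) * G s * indicator {0<..y} s =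
        (\<integral>\<^sup>+u. f2 (u(i := s)) * ennreal (likelihood c l (i # is) y (u(i := s))) \<partial>?N)"
    proof (cases "y < s")
      case True
      then show ?thesis
        using f2_meas by (simp add: nn_integral_multc K2)
    next
      case False
      have "(\<integral>\<^sup>+u. f2 (u(i := s)) * ennreal (likelihood c l (i # is) y (u(i := s))) \<partial>?N) =
        (\<integral>\<^sup>+u. ennreal (c * exp (- ((c - 1) * l * s))) *
          (f2 (u(i := s)) * ennreal (likelihood c l is (y - s) u)) \<partial>?N)"
        using False c by (intro nn_integral_cong) (simp add: lik_upd ennreal_mult likelihood_nonneg mult_ac)
      also have "\<dots> = ennreal (c * exp (- ((c - 1) * l * s))) * G s"
        unfolding G_def using f2_meas lik_meas by (intro nn_integral_cmult) measurable
      finally show ?thesis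
        using False \<open>0 < s\<close> by simp
    qed
  qed
  also have "\<dots> = (\<integral>\<^sup>+u. f2 u * ennreal (likelihood c l (i # is) y u) \<partial>Pi\<^sub>M (insert i I) (\<lambda>_. exp_law l))"
  proof (rule product_nn_integral_insert_rev[symmetric])
    have [measurable]: "(\<lambda>u. likelihood c l (i # is) y u) \<in> borel_measurable (Pi\<^sub>M (insert i I) (\<lambda>_. exp_law l))"
      by (rule likelihood_measurable[where I = "insert i I" and l' = l]) (auto simp: I_def)
    show "(\<lambda>u. f2 u * ennreal (likelihood c l (i # is) y u))
        \<in> borel_measurable (Pi\<^sub>M (insert i I) (\<lambda>_. exp_law l))"
      by measurable
  qed (use I in auto)
  finally show ?case
    by (simp only: I(3) y_def)
qed

text \<open>A pointwise form of Cauchy--Schwarz: the ratio \<open>W\<close> for \<open>c\<close>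
  satisfies \<open>W <= M + W\<^sup>2 / (4 * M) <= M + V / 4\<close>, where the ratio
  \<open>V\<close> for \<open>c\<^sup>2\<close> has mean 1. Integrating over \<open>A2\<close> gives
  the bound.\<close>

lemma indicator_change_of_measure:
  fixes A1 A2 :: "('i \<Rightarrow> real) set"
  assumes l: "0 < l" and c: "0 < c" and J: "finite J" "distinct is" "set is \<inter> J = {}" and z: "0 \<le> z"
    and meas: "A1 \<in> sets (Pi\<^sub>M (set is \<union> J) (\<lambda>_. exp_law l))" "A2 \<in> sets (Pi\<^sub>M (set is \<union> J) (\<lambda>_. exp_law l))"
    and agree: "\<And>u u'. u \<in> (\<Pi>\<^sub>E i\<in>set is \<union> J. {0<..}) \<Longrightarrow> u' \<in> (\<Pi>\<^sub>E i\<in>set is \<union> J. {0<..}) \<Longrightarrow>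
      agree_upto c is z u u' \<Longrightarrow> (\<And>j. j \<in> J \<Longrightarrow> u j = u' j) \<Longrightarrow> u \<in> A1 \<longleftrightarrow> u' \<in> A2"
    and M: "exp ((c - 1)\<^sup>2 * l * (z / c)) \<le> M"
  shows "emeasure (Pi\<^sub>M (set is \<union> J) (\<lambda>_. exp_law l)) A1 \<le>
    ennreal M * emeasure (Pi\<^sub>M (set is \<union> J) (\<lambda>_. exp_law l)) A2 + ennreal (1 / 4)"
proof -
  let ?P = "Pi\<^sub>M (set is \<union> J) (\<lambda>_. exp_law l)"
  interpret P: prob_space ?P
    using l by (intro prob_space_PiM prob_space_exponential_density)
  have "M > 0"
    using M by (rule less_le_trans[rotated]) simp
  have lik_meas: "(\<lambda>u. likelihood c' l is y u) \<in> borel_measurable ?P" for c' y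
    by (rule likelihood_measurable[where I = "set is \<union> J" and l' = l]) auto
  \<comment> \<open>Constant integrands, stretching factor \<open>c\<^sup>2\<close>, and horizon
    \<open>c * z\<close>, chosen so that dividing by \<open>c\<^sup>2\<close> leaves
    \<open>z / c\<close>.\<close>
  have total: "(\<integral>\<^sup>+u. ennreal (likelihood (c\<^sup>2) l is (z / c) u) \<partial>?P) = 1"
    using change_of_measure[of l "c\<^sup>2" J "is" "c * z" "\<lambda>_. 1" "\<lambda>_. 1"] l c J z
    by (simp add: P.emeasure_space_1 power2_eq_square)
  have "emeasure ?P A1 = (\<integral>\<^sup>+u. indicator A1 u \<partial>?P)"
    using meas by simp
  also have "\<dots> = (\<integral>\<^sup>+u. indicator A2 u * ennreal (likelihood c l is (z / c) u) \<partial>?P)"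
    using meas agree by (intro change_of_measure l c J z) (auto simp: indicator_def)
  also have "\<dots> \<le> (\<integral>\<^sup>+u. ennreal M * indicator A2 u +
      ennreal (1 / 4) * ennreal (likelihood (c\<^sup>2) l is (z / c) u) \<partial>?P)"
  proof (intro nn_integral_mono)
    fix u
    show "indicator A2 u * ennreal (likelihood c l is (z / c) u) \<le>
      ennreal M * indicator A2 u + ennreal (1 / 4) * ennreal (likelihood (c\<^sup>2) l is (z / c) u)"
    proof (cases "u \<in> A2")
      case True
      let ?W = "likelihood c l is (z / c) u" and ?V = "likelihood (c\<^sup>2) l is (z / c) u"
      have "?W\<^sup>2 \<le> exp ((c - 1)\<^sup>2 * l * (z / c)) * ?V"
        using l c z by (intro likelihood_square) auto
      also have "\<dots> \<le> M * ?V"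
        using M by (intro mult_right_mono likelihood_nonneg) auto
      finally have "?W\<^sup>2 \<le> M * ?V" .
      moreover have "0 \<le> (?W - 2 * M)\<^sup>2"
        by simp
      ultimately have "M * ?W \<le> M * (M + 1 / 4 * ?V)"
        by (simp add: power2_eq_square algebra_simps)
      then have "?W \<le> M + 1 / 4 * ?V"
        using \<open>M > 0\<close> by simp
      then have "ennreal ?W \<le> ennreal (M + 1 / 4 * ?V)"
        by (rule ennreal_leI)
      also have "\<dots> = ennreal M + ennreal (1 / 4) * ennreal ?V"
        using \<open>M > 0\<close> by (subst ennreal_mult[symmetric]) (auto simp: likelihood_nonneg)
      finally show ?thesis
        using True by simp
    qed simp
  qed
  also have "\<dots> = ennreal M * emeasure ?P A2 + ennreal (1 / 4)"
  proof -
    note [measurable] = meas lik_meas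
    show ?thesis
      by (subst nn_integral_add) (simp_all add: nn_integral_cmult_indicator nn_integral_cmult total)
  qed
  finally show ?thesis .
qed

section \<open>The lower bound\<close>

text \<open>Partial sums match as long as the gaps do; after the first gap that passes the horizon,
  positivity keeps all later points beyond it.\<close>

lemma agree_upto_points:
  assumes "agree_upto c is z u u'" "0 < c" "\<And>i. i \<in> set is \<Longrightarrow> 0 < u i \<and> 0 < u' i"
  shows "sum_list (map u (take m is)) = c * sum_list (map u' (take m is)) \<or>
    z < sum_list (map u (take m is)) \<and> z < c * sum_list (map u' (take m is))"
  using assms
proof (induction "is" arbitrary: z m)
  case (Cons i "is")
  show ?case
  proof (cases m)
    case (Suc m')
    have nonneg: "0 \<le> sum_list (map v (take m' is))" if "\<And>i. i \<in> set is \<Longrightarrow> 0 < v i" for v :: "'a \<Rightarrow> real"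
      using that by (intro sum_list_nonneg) (auto intro: less_imp_le dest: in_set_takeD)
    consider "z < u i" "z < c * u' i" | "u i = c * u' i" "agree_upto c is (z - u i) u u'"
      using Cons.prems by auto
    then show ?thesis
    proof cases
      case 1
      have "0 \<le> sum_list (map u (take m' is))" "0 \<le> c * sum_list (map u' (take m' is))"
        using nonneg Cons.prems by auto
      then show ?thesis
        using 1 Suc by (simp add: distrib_left)
    next
      case 2
      have "sum_list (map u (take m' is)) = c * sum_list (map u' (take m' is)) \<or>
        z - u i < sum_list (map u (take m' is)) \<and> z - u i < c * sum_list (map u' (take m' is))"
        using Cons.prems 2 by (intro Cons.IH) auto
      then show ?thesis
        using 2 Suc by (auto simp: distrib_left)
    qed
  qed simp
qed simp

text \<open>After \<open>e\<close> units of processing, a job of length 1 has progress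
  \<open>e\<close> and one of length \<open>c\<close> has progress \<open>e / c\<close>. Stretching
  the latter's points by \<open>c\<close> puts both on the scale of processing received.\<close>

lemma progress_agree_upto:
  assumes agree: "agree_upto c (map (Pair k) [1..<Suc g]) x w w'"
    and pos: "\<And>i. i \<in> {1..g} \<Longrightarrow> 0 < w (k, i) \<and> 0 < w' (k, i)"
    and c: "1 \<le> c" and e: "0 \<le> e" "e < x" "x \<le> 1"
  shows "progress g w k e = progress g w' k (e / c)"
proof -
  have "threshold g w k h \<le> e \<longleftrightarrow> threshold g w' k h \<le> e / c" for h
  proof (cases "h \<le> g")
    case True
    have eq: "poisson_point v k h = sum_list (map v (take h (map (Pair k) [1..<Suc g])))" for v
    proof -
      have "take h (map (Pair k) [1..<Suc g]) = map (Pair k) [1..<Suc h]"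
        using True by (simp add: take_map del: upt_Suc)
      then show ?thesis
        by (simp add: poisson_point_def interv_sum_list_conv_sum_set_nat o_def atLeastLessThanSuc_atLeastAtMost
          del: upt_Suc)
    qed
    have "poisson_point w k h = c * poisson_point w' k h \<or>
      x < poisson_point w k h \<and> x < c * poisson_point w' k h"
      unfolding eq using agree c pos by (intro agree_upto_points) (auto simp del: upt_Suc)
    \<comment> \<open>As \<open>e < 1\<close>, the cap at 1 does not affect the comparison; likewise
      for the stretched job.\<close>
    moreover have "threshold g w k h \<le> e \<longleftrightarrow> poisson_point w k h \<le> e"
      using True e by (simp add: threshold_def min_le_iff_disj)
    moreover have "threshold g w' k h \<le> e / c \<longleftrightarrow> c * poisson_point w' k h \<le> e"
      using True e c by (simp add: threshold_def min_le_iff_disj field_simps)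
    ultimately show ?thesis
      using e by auto
  next
    case False
    then show ?thesis
      using e c by (simp add: threshold_def field_simps)
  qed
  then show ?thesis
    by (simp add: progress_def)
qed

section \<open>The probability space of the progress bars\<close>

lemma space_bar_space:
  "space (bar_space g n) = (\<Pi>\<^sub>E x\<in>{..<n} \<times> {1..g}. {0<..})"
  by (auto simp: bar_space_def space_restrict_space space_PiM)

lemma positive_sets:
  assumes "finite I"
  shows "{w. \<forall>x\<in>I. 0 < w x} \<inter> space (Pi\<^sub>M I (\<lambda>_. exp_law l)) \<in> sets (Pi\<^sub>M I (\<lambda>_. exp_law l))"
proof -
  have "{w. \<forall>x\<in>I. 0 < w x} \<inter> space (Pi\<^sub>M I (\<lambda>_. exp_law l)) = (\<Pi>\<^sub>E x\<in>I. {0<..})"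
    by (auto simp: space_PiM)
  also have "\<dots> \<in> sets (Pi\<^sub>M I (\<lambda>_. exp_law l))"
    using assms by (intro sets_PiM_I_finite) auto
  finally show ?thesis .
qed

text \<open>Moves events to the full product space, where the change of measure takes place.\<close>

lemma emeasure_bar_space:
  assumes "X \<in> sets (bar_space g n)"
  shows "X \<in> sets (Pi\<^sub>M ({..<n} \<times> {1..g}) (\<lambda>_. exp_law (real g)))"
    and "emeasure (bar_space g n) X = emeasure (Pi\<^sub>M ({..<n} \<times> {1..g}) (\<lambda>_. exp_law (real g))) X"
proof -
  note pos = positive_sets[of "{..<n} \<times> {1..g}" "real g"]
  have "X \<in> sets (Pi\<^sub>M ({..<n} \<times> {1..g}) (\<lambda>_. exp_law (real g))) \<and>
      X \<subseteq> {w. \<forall>x\<in>{..<n} \<times> {1..g}. 0 < w x}"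
    using assms pos by (simp add: bar_space_def sets_restrict_space_iff)
  then show "X \<in> sets (Pi\<^sub>M ({..<n} \<times> {1..g}) (\<lambda>_. exp_law (real g)))"
    and "emeasure (bar_space g n) X = emeasure (Pi\<^sub>M ({..<n} \<times> {1..g}) (\<lambda>_. exp_law (real g))) X"
    using pos by (auto simp: bar_space_def emeasure_restrict_space)
qed

lemma prob_space_bar_space:
  assumes "1 \<le> g"
  shows "prob_space (bar_space g n)"
proof
  let ?P = "Pi\<^sub>M ({..<n} \<times> {1..g}) (\<lambda>_. exp_law (real g))"
  interpret P: prob_space ?P
    using assms by (intro prob_space_PiM prob_space_exponential_density) simp
  have "emeasure (bar_space g n) (space (bar_space g n)) = emeasure ?P (space (bar_space g n))"
    by (rule emeasure_bar_space(2)) simp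
  also have "\<dots> = 1"
  proof (rule P.emeasure_eq_1_AE)
    show "space (bar_space g n) \<in> sets ?P"
      by (rule emeasure_bar_space(1)) simp
    show "AE w in ?P. w \<in> space (bar_space g n)"
      unfolding space_bar_space using assms by (intro AE_PiM_exp_law_pos) auto
  qed
  finally show "emeasure (bar_space g n) (space (bar_space g n)) = 1" .
qed

lemma execution_run:
  assumes "scheduling_algorithm g S A" "\<And>j. j < n \<Longrightarrow> 0 < p j" "\<omega> \<in> space S" "w \<in> space (bar_space g n)"
  shows "execution g n p w (A \<omega> n) (run g n p w (A \<omega> n))"
proof -
  have "\<exists>r. execution g n p w (A \<omega> n) r"
    using assms unfolding scheduling_algorithm_def by blast
  then show ?thesis
    unfolding run_def by (rule someI_ex)
qed

text \<open>The event of the opening overview, on the joint space of seeds and bars so as to cover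
  randomized algorithms.\<close>

definition late_event ::
  "nat \<Rightarrow> 's measure \<Rightarrow> ('s \<Rightarrow> nat \<Rightarrow> policy) \<Rightarrow> nat \<Rightarrow> (nat \<Rightarrow> real) \<Rightarrow> real \<Rightarrow> nat \<Rightarrow> nat \<Rightarrow>
    ('s \<times> (nat \<times> nat \<Rightarrow> real)) set" where
  "late_event g S A n p x k l =
     {z \<in> space (S \<Otimes>\<^sub>M bar_space g n). \<not> follows x k l (run g n p (snd z) (A (fst z) n))}"

lemma late_event_sets:
  assumes "scheduling_algorithm g S A" "\<And>j. j < n \<Longrightarrow> 0 < p j" "k < n" "l < n"
  shows "late_event g S A n p x k l \<in> sets (S \<Otimes>\<^sub>M bar_space g n)"
proof -
  have [measurable]: "(\<lambda>z. elapsed (run g n p (snd z) (A (fst z) n)) j t) \<in>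
      borel_measurable (S \<Otimes>\<^sub>M bar_space g n)" if "j < n" "0 \<le> t" for j t
  proof -
    have "(\<lambda>(\<omega>, w). elapsed (run g n p w (A \<omega> n)) j t) \<in> borel_measurable (S \<Otimes>\<^sub>M bar_space g n)"
      using assms(1,2) that unfolding scheduling_algorithm_def by blast
    then show ?thesis
      by (simp add: case_prod_beta)
  qed
  have "(\<Union>t\<in>{t\<in>\<rat>. 0 \<le> t}. {z \<in> space (S \<Otimes>\<^sub>M bar_space g n).
      elapsed (run g n p (snd z) (A (fst z) n)) k t < x \<and>
      x < elapsed (run g n p (snd z) (A (fst z) n)) l t}) \<in> sets (S \<Otimes>\<^sub>M bar_space g n)" (is "?U \<in> _")
  proof (intro sets.countable_UN'')
    show "countable {t\<in>\<rat>. (0::real) \<le> t}"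
      by (rule countable_subset[OF _ countable_rat]) auto
    fix t :: real
    assume "t \<in> {t\<in>\<rat>. 0 \<le> t}"
    then have [simp]: "0 \<le> t"
      by simp
    note [simp] = assms(3,4)
    show "{z \<in> space (S \<Otimes>\<^sub>M bar_space g n).
        elapsed (run g n p (snd z) (A (fst z) n)) k t < x \<and>
        x < elapsed (run g n p (snd z) (A (fst z) n)) l t} \<in> sets (S \<Otimes>\<^sub>M bar_space g n)"
      by measurable
  qed
  then have "space (S \<Otimes>\<^sub>M bar_space g n) - ?U \<in> sets (S \<Otimes>\<^sub>M bar_space g n)"
    by (rule sets.compl_sets)
  also have "space (S \<Otimes>\<^sub>M bar_space g n) - ?U = late_event g S A n p x k l"
    by (auto simp: late_event_def follows_def)
  finally show ?thesis .
qed

lemma mem_late_event: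
  assumes "\<omega> \<in> space S" "w \<in> space (bar_space g n)"
  shows "(\<omega>, w) \<in> late_event g S A n p x k l \<longleftrightarrow> \<not> follows x k l (run g n p w (A \<omega> n))"
  using assms by (simp add: late_event_def space_pair_measure)

text \<open>For a fixed seed the same policy runs in both instances, which both have two jobs, and
  it sees them only through the displays. These agree for job \<open>l\<close> throughout and for
  job \<open>k\<close> below \<open>x\<close>.\<close>

lemma late_event_cong:
  assumes A: "scheduling_algorithm g S A" and kl: "{k, l} = {0, 1}" and d: "0 \<le> d" and x: "x \<le> 1"
    and \<omega>: "\<omega> \<in> space S" and w: "w \<in> space (bar_space g 2)" "w' \<in> space (bar_space g 2)"
    and agree: "agree_upto (1 + d) (map (Pair k) [1..<Suc g]) x w w'"
      "\<And>i. i \<in> {1..g} \<Longrightarrow> w (l, i) = w' (l, i)"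
  shows "(\<omega>, w) \<in> late_event g S A 2 (\<lambda>_. 1) x k l \<longleftrightarrow>
    (\<omega>, w') \<in> late_event g S A 2 (\<lambda>j. if j = k then 1 + d else 1) x k l"
proof -
  let ?p = "\<lambda>j. if j = k then 1 + d else 1"
  have k2: "k < 2" "l < 2" "k \<noteq> l"
    using kl by (auto simp: doubleton_eq_iff)
  have p: "0 < ?p j" for j
    using d by simp
  have "follows x k l (run g 2 (\<lambda>_. 1) w (A \<omega> 2)) \<longleftrightarrow> follows x k l (run g 2 ?p w' (A \<omega> 2))"
  proof (rule follows_execution_cong[OF execution_run[OF A _ \<omega> w(1)] execution_run[OF A _ \<omega> w(2)]])
    fix j e
    assume j: "j < 2" and e: "0 \<le> (e::real)" "j = k \<longrightarrow> e < x"
    show "progress g w j (e / 1) = progress g w' j (e / ?p j)"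
    proof (cases "j = k")
      case True
      have "progress g w k e = progress g w' k (e / (1 + d))"
      proof (rule progress_agree_upto[OF agree(1)])
        show "0 < w (k, i) \<and> 0 < w' (k, i)" if "i \<in> {1..g}" for i
          using w k2 that by (auto simp: space_bar_space PiE_iff)
      qed (use d x e True in auto)
      then show ?thesis
        using True by simp
    next
      case False
      then have "j = l"
        using j kl by (auto simp: doubleton_eq_iff)
      have "poisson_point w j h = poisson_point w' j h" if "h \<le> g" for h
        unfolding poisson_point_def \<open>j = l\<close> using that by (intro sum.cong refl agree(2)) auto
      then have "threshold g w j h = threshold g w' j h" for h
        by (simp add: threshold_def)
      then show ?thesis
        using False by (simp add: progress_def)
    qed
  qed (use p k2 in auto)
  then show ?thesis
    using \<omega> w by (simp add: mem_late_event)
qed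

theorem theorem6:
  fixes g :: nat and S :: "'s measure" and A :: "'s \<Rightarrow> nat \<Rightarrow> policy"
  assumes "1 \<le> g"
    and "scheduling_algorithm g S A"
  shows "\<exists>n p. 1 \<le> n \<and> (\<forall>j<n. 0 < p j) \<and>
           ennreal (1 + 1 / 36 * real g powr (- 1 / 3)) * OPT n p \<le> expected_cost g S A n p"
proof -
  \<comment> \<open>The order \<open>g powr (- 1 / 3)\<close> keeps \<open>g * x ^ 3\<close>
    bounded; the factor 1/2 makes it 1/8.\<close>
  define x where "x = real g powr (- 1 / 3) / 2"
  have x: "0 < x" "x \<le> 1 / 2"
    using assms(1) powr_mono2'[of "- 1 / 3" 1 "real g"] by (auto simp: x_def)
  have gx: "real g * x ^ 3 = 1 / 8"
  proof -
    have "(real g powr (- 1 / 3)) ^ 3 = real g powr (- 1)"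
      using assms(1) by (subst powr_power) auto
    then show ?thesis
      using assms(1) by (simp add: x_def power_divide powr_minus field_simps)
  qed
  let ?bar = "bar_space g 2"
  let ?I = "{..<2::nat} \<times> {1..g}"
  interpret S: prob_space S
    using assms(2) by (simp add: scheduling_algorithm_def)
  interpret bar: prob_space ?bar
    by (rule prob_space_bar_space) fact
  interpret pair_prob_space S ?bar ..
  define Q where "Q = (\<lambda>p k l. late_event g S A 2 p x k l)"
  have Q_sets: "Q p k l \<in> sets (S \<Otimes>\<^sub>M ?bar)"
    if "\<And>j. j < 2 \<Longrightarrow> 0 < p j" "k < 2" "l < 2" for p k l
    unfolding Q_def by (rule late_event_sets[OF assms(2) that])
  \<comment> \<open>By \<open>not_follows_both\<close> every run lies in at least one of the two
    events. The job \<open>k\<close> chosen next depends on the algorithm but not on its random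
    outcome.\<close>
  have Q_total: "1 \<le> emeasure (S \<Otimes>\<^sub>M ?bar) (Q (\<lambda>_. 1) 0 1) + emeasure (S \<Otimes>\<^sub>M ?bar) (Q (\<lambda>_. 1) 1 0)"
  proof -
    have "space (S \<Otimes>\<^sub>M ?bar) = Q (\<lambda>_. 1) 0 1 \<union> Q (\<lambda>_. 1) 1 0"
      using execution_run[OF assms(2), of 2 "\<lambda>_. 1"] not_follows_both[of 2 "\<lambda>_. 1" _ 0 1]
      by (auto simp: Q_def late_event_def space_pair_measure execution_def)
    then show ?thesis
      using emeasure_space_1 emeasure_subadditive[OF Q_sets[of "\<lambda>_. 1" 0 1] Q_sets[of "\<lambda>_. 1" 1 0]]
      by simp
  qed
  have "\<exists>k l. {k, l} = {0, 1::nat} \<and> 1 / 2 \<le> measure (S \<Otimes>\<^sub>M ?bar) (Q (\<lambda>_. 1) k l)"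
  proof -
    have "1 \<le> prob (Q (\<lambda>_. 1) 0 1) + prob (Q (\<lambda>_. 1) 1 0)"
      using Q_total by (simp add: emeasure_eq_measure flip: ennreal_plus)
    then have "1 / 2 \<le> prob (Q (\<lambda>_. 1) 0 1) \<or> 1 / 2 \<le> prob (Q (\<lambda>_. 1) 1 0)"
      by auto
    then show ?thesis
      by (auto simp: insert_commute)
  qed
  then obtain k l where kl: "{k, l} = {0, 1::nat}"
    and half: "1 / 2 \<le> prob (Q (\<lambda>_. 1) k l)"
    by blast
  have k2: "k < 2" "l < 2" "k \<noteq> l"
    using kl by (auto simp: doubleton_eq_iff)
  define p where "p = (\<lambda>j. if j = k then 1 + x else 1)"
  have p: "0 < p j" "p k = 1 + x" "p l = 1" for j
    using x k2 by (auto simp: p_def)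
  \<comment> \<open>The gaps of the long job are stretched, in their order; those of the short job
    are shared.\<close>
  define gaps where "gaps = map (Pair k) [1..<Suc g]"
  define J where "J = {l} \<times> {1..g}"
  have gaps: "distinct gaps" "finite J" "set gaps \<inter> J = {}" "set gaps \<union> J = ?I"
  proof -
    show "set gaps \<union> J = ?I"
      using kl unfolding gaps_def J_def by (auto simp: doubleton_eq_iff less_2_cases_iff simp del: upt_Suc)
  qed (use k2 in \<open>auto simp: gaps_def J_def distinct_map inj_on_def simp del: upt_Suc\<close>)
  have section_sets: "Pair \<omega> -` Q p' k l \<in> sets ?bar" if "\<And>j. j < 2 \<Longrightarrow> 0 < p' j" for \<omega> p'
    using Q_sets[OF that k2(1,2)] by (rule sets_Pair1)
  have M: "exp ((1 + x - 1)\<^sup>2 * real g * (x / (1 + x))) \<le> 8 / 7"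
  proof -
    have "(1 + x - 1)\<^sup>2 * real g * (x / (1 + x)) = real g * x ^ 3 / (1 + x)"
      by (simp add: power2_eq_square power3_eq_cube)
    also have "\<dots> \<le> 1 / 8"
      using x gx by (simp add: field_simps)
    finally have "exp ((1 + x - 1)\<^sup>2 * real g * (x / (1 + x))) \<le> exp (1 / 8)"
      by simp
    \<comment> \<open>From \<open>exp (- 1 / 8) >= 1 - 1 / 8\<close>.\<close>
    also have "exp (1 / 8) \<le> (8 / 7 :: real)"
      using exp_ge_add_one_self[of "- 1 / 8 :: real"] by (simp add: exp_minus field_simps)
    finally show ?thesis .
  qed
  \<comment> \<open>The change of measure is applied for each fixed seed; integrating over the seeds
    then gives the bound on the joint space.\<close>
  have "emeasure ?bar (Pair \<omega> -` Q (\<lambda>_. 1) k l) \<le>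
      ennreal (8 / 7) * emeasure ?bar (Pair \<omega> -` Q p k l) + ennreal (1 / 4)"
    if \<omega>: "\<omega> \<in> space S" for \<omega>
  proof -
    have 1: "Pair \<omega> -` Q (\<lambda>_. 1) k l \<in> sets ?bar" and 2: "Pair \<omega> -` Q p k l \<in> sets ?bar"
      using p by (auto intro!: section_sets)
    show ?thesis
      unfolding emeasure_bar_space(2)[OF 1] emeasure_bar_space(2)[OF 2] gaps(4)[symmetric]
    proof (rule indicator_change_of_measure[where c = "1 + x" and z = x])
      show "Pair \<omega> -` Q (\<lambda>_. 1) k l \<in> sets (Pi\<^sub>M (set gaps \<union> J) (\<lambda>_. exp_law (real g)))"
        "Pair \<omega> -` Q p k l \<in> sets (Pi\<^sub>M (set gaps \<union> J) (\<lambda>_. exp_law (real g)))"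
        unfolding gaps(4) using emeasure_bar_space(1)[OF 1] emeasure_bar_space(1)[OF 2] .
      fix u u'
      assume "u \<in> (\<Pi>\<^sub>E i\<in>set gaps \<union> J. {0<..})" "u' \<in> (\<Pi>\<^sub>E i\<in>set gaps \<union> J. {0<..})"
        and agree: "agree_upto (1 + x) gaps x u u'" "\<And>j. j \<in> J \<Longrightarrow> u j = u' j"
      then have u: "u \<in> space ?bar" "u' \<in> space ?bar"
        unfolding gaps(4) space_bar_space by auto
      then show "u \<in> Pair \<omega> -` Q (\<lambda>_. 1) k l \<longleftrightarrow> u' \<in> Pair \<omega> -` Q p k l"
        unfolding Q_def p_def vimage_eq using x agree
        by (intro late_event_cong assms(2) kl \<omega> u) (auto simp: gaps_def J_def)
    qed (use assms(1) x gaps M in auto)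
  qed
  then have "(\<integral>\<^sup>+\<omega>. emeasure ?bar (Pair \<omega> -` Q (\<lambda>_. 1) k l) \<partial>S) \<le>
      (\<integral>\<^sup>+\<omega>. ennreal (8 / 7) * emeasure ?bar (Pair \<omega> -` Q p k l) + ennreal (1 / 4) \<partial>S)"
    by (rule nn_integral_mono)
  also have "\<dots> = ennreal (8 / 7) * emeasure (S \<Otimes>\<^sub>M ?bar) (Q p k l) + ennreal (1 / 4)"
  proof -
    have Qp: "Q p k l \<in> sets (S \<Otimes>\<^sub>M ?bar)"
      using Q_sets p k2 by blast
    note [measurable] = bar.measurable_emeasure_Pair[OF Qp]
    show ?thesis
      by (subst nn_integral_add)
        (simp_all add: nn_integral_cmult bar.emeasure_pair_measure_alt[OF Qp] S.emeasure_space_1)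
  qed
  also have "(\<integral>\<^sup>+\<omega>. emeasure ?bar (Pair \<omega> -` Q (\<lambda>_. 1) k l) \<partial>S) = emeasure (S \<Otimes>\<^sub>M ?bar) (Q (\<lambda>_. 1) k l)"
    using Q_sets[of "\<lambda>_. 1" k l] k2 by (simp add: bar.emeasure_pair_measure_alt)
  also have "ennreal (8 / 7) * emeasure (S \<Otimes>\<^sub>M ?bar) (Q p k l) + ennreal (1 / 4) =
      ennreal (8 / 7 * prob (Q p k l) + 1 / 4)"
    unfolding emeasure_eq_measure by (subst ennreal_mult[symmetric], simp, simp) (rule ennreal_plus[symmetric]; simp)
  finally have "ennreal (prob (Q (\<lambda>_. 1) k l)) \<le> ennreal (8 / 7 * prob (Q p k l) + 1 / 4)"
    by (simp only: emeasure_eq_measure)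
  then have "prob (Q (\<lambda>_. 1) k l) \<le> 8 / 7 * prob (Q p k l) + 1 / 4"
    by (subst (asm) ennreal_le_iff) auto
  \<comment> \<open>\<open>7 / 32 = (1 / 2 - 1 / 4) / (8 / 7)\<close>.\<close>
  then have late: "7 / 32 \<le> prob (Q p k l)"
    using half by simp
  have "ennreal (3 + x) + ennreal x * emeasure (S \<Otimes>\<^sub>M ?bar) (Q p k l) =
      (\<integral>\<^sup>+z. ennreal (3 + x) + ennreal x * indicator (Q p k l) z \<partial>(S \<Otimes>\<^sub>M ?bar))"
    using Q_sets[of p k l] p k2
    by (subst nn_integral_add) (auto simp: nn_integral_cmult_indicator emeasure_space_1)
  also have "\<dots> = (\<integral>\<^sup>+\<omega>. \<integral>\<^sup>+w. ennreal (3 + x) + ennreal x * indicator (Q p k l) (\<omega>, w) \<partial>?bar \<partial>S)"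
    using Q_sets[of p k l] p k2 by (intro bar.nn_integral_fst[symmetric]) auto
  also have "\<dots> \<le> expected_cost g S A 2 p"
    unfolding expected_cost_def
  proof (intro nn_integral_mono)
    fix \<omega> w
    assume "\<omega> \<in> space S" "w \<in> space ?bar"
    then have "schedule 2 p (run g 2 p w (A \<omega> 2))" and
      "indicator (Q p k l) (\<omega>, w) =
        (indicator {r. \<not> follows x k l r} (run g 2 p w (A \<omega> 2)) :: ennreal)"
      using execution_run[OF assms(2), of 2 p] p by (auto simp: execution_def Q_def mem_late_event indicator_def)
    then show "ennreal (3 + x) + ennreal x * indicator (Q p k l) (\<omega>, w) \<le>
        total_completion_time 2 p (run g 2 p w (A \<omega> 2))"
      using total_completion_time_ge[OF _ kl p(2,3), of _ x] x by simp
  qed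
  also have "ennreal (3 + x) + ennreal x * emeasure (S \<Otimes>\<^sub>M ?bar) (Q p k l) =
      ennreal (3 + x + x * prob (Q p k l))"
    unfolding emeasure_eq_measure using x
    by (subst ennreal_mult[symmetric], simp, simp) (rule ennreal_plus[symmetric]; simp)
  finally have cost: "ennreal (3 + x + x * prob (Q p k l)) \<le> expected_cost g S A 2 p" .
  have "ennreal (1 + 1 / 36 * real g powr (- 1 / 3)) * OPT 2 p \<le> ennreal (1 + x / 18) * ennreal (3 + x)"
    using OPT_le[OF kl p(2,3)] x by (intro mult_mono) (auto simp: x_def)
  also have "\<dots> = ennreal ((1 + x / 18) * (3 + x))"
    using x by (simp add: ennreal_mult)
  also have "\<dots> \<le> ennreal (3 + x + x * prob (Q p k l))"
  proof (rule ennreal_leI)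
    \<comment> \<open>With \<open>x <= 1 / 2\<close>,
      \<open>(3 + x) / 18 <= 7 / 36 <= 7 / 32\<close>; and \<open>x / 18\<close> is the
      \<open>1 / 36 * g powr (- 1 / 3)\<close> of the claim.\<close>
    have "x * ((3 + x) / 18) \<le> x * prob (Q p k l)"
      using x late by (intro mult_left_mono) auto
    then show "(1 + x / 18) * (3 + x) \<le> 3 + x + x * prob (Q p k l)"
      by (simp add: field_simps)
  qed
  also note cost
  finally show ?thesis
    using p by (intro exI[of _ 2] exI[of _ p]) auto
qed

end
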